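(* Let $\vec x=F(\vec x)$ be a polynomial system of equations over $\overline{\mathbb N}=\mathbb N\cup\{\omega\}$. The minimal solution of this system can be computed from $F$; that is, there is an algorithm which, given the polynomials $F=(f_1,\dots,f_n)$, outputs the minimal solution of $\vec x=F(\vec x)$.
   Context: $\overline{\mathbb N}=\mathbb N\cup\{\omega\}$ with the order and operations of $\mathbb N$ extended by: $i\le\omega$ and $i+\omega=\omega+i=\omega$ for every $i\in\overline{\mathbb N}$; $0\cdot\omega=\omega\cdot0=0$; $i\cdot\omega=\omega\cdot i=\omega$ for every $i\ne0$. $\overline{\mathbb N}^k$ is ordered componentwise. Polynomials are the functions of several variables over $\overline{\mathbb N}$ in the least set containing the constants (including $\omega$) and the variables and closed under addition and multiplication; they are given as input by polynomial expressions. A polynomial system of equations is a set of equations $x_i=f_i(x_1,\dots,x_n)$, $1\le i\le n$, with each $f_i$ a polynomial, abbreviated $\vec x=F(\vec x)$. A minimal solution is $\vec a$ with $\vec a=F(\vec a)$ and $\vec a\le\vec b$ for every $\vec b$ with $\vec b=F(\vec b)$. *)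

theory Defs
  imports "HOL-Library.Extended_Nat" "HOL-Library.Nat_Bijection"
begin

section \<open>Polynomial systems of equations over the extended naturals\<close>

text \<open>The semiring \<open>\<nat> \<union> {\<omega>}\<close> is the library type \<^typ>\<open>enat\<close>, in which \<open>0 * \<infinity> = 0\<close>.\<close>

datatype pexp = Const enat | Var nat | Add pexp pexp | Mult pexp pexp

primrec vars :: "pexp \<Rightarrow> nat set" where
  "vars (Const c) = {}"
| "vars (Var i) = {i}"
| "vars (Add p q) = vars p \<union> vars q"
| "vars (Mult p q) = vars p \<union> vars q"

primrec peval :: "enat list \<Rightarrow> pexp \<Rightarrow> enat" where
  "peval a (Const c) = c"
| "peval a (Var i) = a ! i"
| "peval a (Add p q) = peval a p + peval a q"
| "peval a (Mult p q) = peval a p * peval a q"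

text \<open>
  The list \<open>F = [f\<^sub>0, \<dots>, f\<^sub>n\<^sub>-\<^sub>1]\<close> represents the system \<open>x\<^sub>i = f\<^sub>i(x\<^sub>0, \<dots>, x\<^sub>n\<^sub>-\<^sub>1)\<close>, \<open>i < n\<close>; no
  other variables may occur in it.
\<close>

definition poly_system :: "pexp list \<Rightarrow> bool" where
  "poly_system F \<longleftrightarrow> (\<forall>f \<in> set F. vars f \<subseteq> {..<length F})"

definition solution :: "pexp list \<Rightarrow> enat list \<Rightarrow> bool" where
  "solution F a \<longleftrightarrow> length a = length F \<and> a = map (peval a) F"

definition minimal_solution :: "pexp list \<Rightarrow> enat list \<Rightarrow> bool" where
  "minimal_solution F a \<longleftrightarrow> solution F a \<and> (\<forall>b. solution F b \<longrightarrow> list_all2 (\<le>) a b)"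

lemma minimal_solution_unique:
  "minimal_solution F a \<Longrightarrow> minimal_solution F b \<Longrightarrow> a = b"
  by (auto simp: minimal_solution_def intro!: list_all2_antisym[of "(\<le>)" "(\<le>)"])


section \<open>Algorithms: partial recursive functions\<close>

text \<open>
  Kleene's schemes: zero, successor, projection, composition, primitive recursion on the first
  argument, and unbounded minimisation over the first argument.
\<close>

datatype recf =
    Zero
  | Succ
  | Proj nat
  | Comp recf "recf list"
  | PrimRec recf recf
  | Mu recf

text \<open>
  \<open>computes r xs y\<close>: on input \<open>xs\<close> the program \<open>r\<close> halts with output \<open>y\<close>. For minimisation, all
  earlier values of the body must be defined and nonzero.
\<close>

inductive computes :: "recf \<Rightarrow> nat list \<Rightarrow> nat \<Rightarrow> bool" where
  Zero: "computes Zero xs 0"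
| Succ: "computes Succ [x] (Suc x)"
| Proj: "i < length xs \<Longrightarrow> computes (Proj i) xs (xs ! i)"
| Comp: "list_all2 (\<lambda>g y. computes g xs y) gs ys \<Longrightarrow> computes f ys z
    \<Longrightarrow> computes (Comp f gs) xs z"
| PrimRec_0: "computes f xs y \<Longrightarrow> computes (PrimRec f g) (0 # xs) y"
| PrimRec_Suc: "computes (PrimRec f g) (n # xs) z \<Longrightarrow> computes g (n # z # xs) y
    \<Longrightarrow> computes (PrimRec f g) (Suc n # xs) y"
| Mu: "computes f (y # xs) 0 \<Longrightarrow> (\<And>z. z < y \<Longrightarrow> \<exists>v. computes f (z # xs) (Suc v))
    \<Longrightarrow> computes (Mu f) xs y"

inductive_cases ZeroE: "computes Zero xs y"
inductive_cases SuccE: "computes Succ xs y"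
inductive_cases ProjE: "computes (Proj i) xs y"
inductive_cases CompE: "computes (Comp f gs) xs y"
inductive_cases PrimRec_0E: "computes (PrimRec f g) (0 # xs) y"
inductive_cases PrimRec_SucE: "computes (PrimRec f g) (Suc n # xs) y"
inductive_cases MuE: "computes (Mu f) xs y"

lemma computes_deterministic:
  "computes r xs y \<Longrightarrow> computes r xs z \<Longrightarrow> y = z"
proof (induction arbitrary: z rule: computes.induct)
  case (Comp xs gs ys f w z)
  from Comp.prems obtain ys' where
    ys': "list_all2 (\<lambda>g y. computes g xs y) gs ys'" "computes f ys' z"
    by (elim CompE)
  have "ys = ys'"
  proof (rule nth_equalityI)
    show "length ys = length ys'"
      using Comp.IH(1) ys'(1) by (simp add: list_all2_conv_all_nth)
    fix i assume "i < length ys"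
    then show "ys ! i = ys' ! i"
      using Comp.IH(1) ys'(1) unfolding list_all2_conv_all_nth by metis
  qed
  with Comp.IH(2) ys'(2) show ?case by simp
next
  case (PrimRec_Suc f g n xs w y z)
  from PrimRec_Suc.prems obtain w' where
    "computes (PrimRec f g) (n # xs) w'" "computes g (n # w' # xs) z"
    by (elim PrimRec_SucE)
  with PrimRec_Suc.IH show ?case by blast
next
  case (Mu f y xs z)
  have z: "computes f (z # xs) 0"
    by (rule MuE[OF Mu.prems])
  have less_z: "\<exists>v. computes f (u # xs) (Suc v)" if "u < z" for u
    by (rule MuE[OF Mu.prems]) (use that in blast)
  show ?case
  proof (rule linorder_cases[of y z])
    assume "y < z"
    from less_z[OF this] obtain v where "computes f (y # xs) (Suc v)" ..
    from Mu.IH(1)[OF this] show ?thesis by simp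
  next
    assume "z < y"
    from Mu.IH(2)[OF this] z show ?thesis by blast
  qed simp
qed (blast elim: ZeroE SuccE ProjE PrimRec_0E)+


section \<open>Coding of inputs and outputs\<close>

definition enat_code :: "enat \<Rightarrow> nat" where
  "enat_code x = (case x of enat n \<Rightarrow> Suc n | \<infinity> \<Rightarrow> 0)"

primrec pexp_code :: "pexp \<Rightarrow> nat" where
  "pexp_code (Const c) = prod_encode (0, enat_code c)"
| "pexp_code (Var i) = prod_encode (1, i)"
| "pexp_code (Add p q) = prod_encode (2, prod_encode (pexp_code p, pexp_code q))"
| "pexp_code (Mult p q) = prod_encode (3, prod_encode (pexp_code p, pexp_code q))"

definition system_code :: "pexp list \<Rightarrow> nat" where
  "system_code F = list_encode (map pexp_code F)"

definition vector_code :: "enat list \<Rightarrow> nat" where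
  "vector_code a = list_encode (map enat_code a)"

lemma inj_enat_code: "inj enat_code"
  by (auto simp: inj_def enat_code_def split: enat.splits)

lemma inj_pexp_code: "inj pexp_code"
proof -
  have "p = q" if "pexp_code p = pexp_code q" for p q
    using that
  proof (induction p arbitrary: q)
    case (Const c)
    then show ?case using inj_enat_code by (cases q) (auto dest: injD)
  next
    case (Var i)
    then show ?case by (cases q) auto
  next
    case (Add p1 p2)
    then show ?case by (cases q) auto
  next
    case (Mult p1 p2)
    then show ?case by (cases q) auto
  qed
  then show ?thesis by (rule injI)
qed

lemma inj_system_code: "inj system_code"
  by (rule injI) (simp add: system_code_def list_encode_eq inj_map_eq_map[OF inj_pexp_code])

lemma inj_vector_code: "inj vector_code"
  by (rule injI) (simp add: vector_code_def list_encode_eq inj_map_eq_map[OF inj_enat_code])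

end

(*
  Let a_k = F^k(0) be the Kleene iterates, mu their supremum and n the number of equations.

  The set of all i with mu_i finite and a_k,i = mu_i grows with k and, once it repeats, is constant:
  a polynomial below its value at mu stays below as long as the same arguments stay below theirs.
  So it is final after n steps, and every finite component of mu is reached at stage n. Likewise,
  for fixed c, the set of all i with a_{c+k},i > a_c,i is final at k = n, so a component that
  agrees at stages c and c + n never changes after stage c. Hence, for every N >= n, mu_i is
  a_{N+1},i if this equals a_{2N+1},i, and infinite otherwise; this is primitive recursive.
*)
theory Submission imports Defs begin

section \<open>Stabilisation of the Kleene iterates\<close>

lemma peval_mono:
  "\<forall>j\<in>vars p. a ! j \<le> b ! j \<Longrightarrow> peval a p \<le> peval b p"
  by (induction p) (auto intro: add_mono mult_mono)

text \<open>Here \<open>u\<close> is positive, being above \<open>x\<close>. Since \<open>v\<close>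
  is positive too and the product is finite, both factors are finite, so cancellation in the natural
  numbers applies: \<open>x * y \<le> x * v < u * v\<close>.\<close>

lemma enat_mult_less_mono:
  fixes x y u v :: enat
  assumes "x < u" "y \<le> v" "0 < v" "u * v \<noteq> \<infinity>"
  shows "x * y < u * v"
  using assms
  by (cases x; cases y; cases u; cases v)
    (auto simp: zero_enat_def intro: le_less_trans[OF mult_le_mono2 mult_less_mono1])

text \<open>A finite sum falls short of its value at \<open>b\<close> exactly when a summand does. A
  product that falls short is nonzero at \<open>b\<close>, so its factors are positive and finite,
  and one of them falls short. The induction thus descends only through finite values, which is why
  variables with value \<infinity> at \<open>b\<close> may be exempted in the third
  assumption.\<close>

lemma peval_less_mono:
  assumes "\<forall>j\<in>vars p. a ! j \<le> b ! j" "\<forall>j\<in>vars p. a' ! j \<le> b ! j"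
    and "\<forall>j\<in>vars p. a ! j < b ! j \<longrightarrow> a' ! j < b ! j \<or> b ! j = \<infinity>"
    and "peval a p < peval b p" "peval b p \<noteq> \<infinity>"
  shows "peval a' p < peval b p"
  using assms
proof (induction p)
  case (Add p q)
  have le: "peval a p \<le> peval b p" "peval a q \<le> peval b q"
           "peval a' p \<le> peval b p" "peval a' q \<le> peval b q"
    using Add.prems by (auto intro!: peval_mono)
  have fin: "peval b p \<noteq> \<infinity>" "peval b q \<noteq> \<infinity>"
    using Add.prems(5) by (cases "peval b p"; cases "peval b q"; simp)+
  have "peval a p < peval b p \<or> peval a q < peval b q"
    using Add.prems(4) le by (auto simp: order_le_less)
  then have "peval a' p < peval b p \<or> peval a' q < peval b q"
    using Add fin by auto
  then show ?case using le fin
    by (cases "peval a' p"; cases "peval a' q"; cases "peval b p"; cases "peval b q") auto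
next
  case (Mult p q)
  have le: "peval a p \<le> peval b p" "peval a q \<le> peval b q"
           "peval a' p \<le> peval b p" "peval a' q \<le> peval b q"
    using Mult.prems by (auto intro!: peval_mono)
  have pos: "0 < peval b p" "0 < peval b q"
    using Mult.prems(4) by (auto simp: zero_less_iff_neq_zero)
  have fin: "peval b p \<noteq> \<infinity>" "peval b q \<noteq> \<infinity>"
    using Mult.prems(5) pos by (auto simp: imult_is_infinity)
  have "peval a p < peval b p \<or> peval a q < peval b q"
    using Mult.prems(4) le by (auto simp: order_le_less)
  then have "peval a' p < peval b p \<or> peval a' q < peval b q"
    using Mult fin by auto
  then show ?case
  proof
    assume "peval a' p < peval b p"
    from enat_mult_less_mono[OF this le(4) pos(2)] Mult.prems(5) show ?thesis by simp
  next
    assume "peval a' q < peval b q"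
    from enat_mult_less_mono[OF this le(3) pos(1)] Mult.prems(5) show ?thesis
      by (simp add: mult.commute)
  qed
qed auto

text \<open>The counterpart with the lower point fixed: growth from \<open>a\<close> to
  \<open>b'\<close> is traced to a variable that grows, and this variable grows at \<open>b\<close>
  too. No finiteness has to be assumed, because a value at \<open>a\<close> that can grow is finite;
  if the product at \<open>b\<close> is infinite, the claim is immediate.\<close>

lemma peval_grows:
  assumes "\<forall>j\<in>vars p. a ! j \<le> b ! j" "\<forall>j\<in>vars p. a ! j \<le> b' ! j"
    and "\<forall>j\<in>vars p. a ! j < b' ! j \<longrightarrow> a ! j < b ! j"
    and "peval a p < peval b' p"
  shows "peval a p < peval b p"
  using assms
proof (induction p)
  case (Add p q)
  have le: "peval a p \<le> peval b p" "peval a q \<le> peval b q"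
           "peval a p \<le> peval b' p" "peval a q \<le> peval b' q"
    using Add.prems by (auto intro!: peval_mono)
  have fin: "peval a p \<noteq> \<infinity>" "peval a q \<noteq> \<infinity>"
    using Add.prems(4) by (cases "peval a p"; cases "peval a q"; simp)+
  have "peval a p < peval b' p \<or> peval a q < peval b' q"
    using Add.prems(4) le by (auto simp: order_le_less)
  then have "peval a p < peval b p \<or> peval a q < peval b q"
    using Add by auto
  then show ?case using le fin
    by (cases "peval a p"; cases "peval a q"; cases "peval b p"; cases "peval b q") auto
next
  case (Mult p q)
  have le: "peval a p \<le> peval b p" "peval a q \<le> peval b q"
           "peval a p \<le> peval b' p" "peval a q \<le> peval b' q"
    using Mult.prems by (auto intro!: peval_mono)
  have pos': "peval b' p \<noteq> 0" "peval b' q \<noteq> 0"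
    using Mult.prems(4) by (auto simp: zero_less_iff_neq_zero)
  have gr: "peval a p < peval b' p \<Longrightarrow> peval a p < peval b p"
    "peval a q < peval b' q \<Longrightarrow> peval a q < peval b q"
    using Mult by auto
  have ex: "peval a p < peval b' p \<or> peval a q < peval b' q"
    using Mult.prems(4) le by (auto simp: order_le_less)
  \<comment> \<open>A factor that is zero at \<open>a\<close> but not at \<open>b'\<close> grows,
    hence is positive at \<open>b\<close>; a factor already positive at \<open>a\<close> stays so by
    monotonicity.\<close>
  have pos: "0 < peval b p" "0 < peval b q"
    using gr pos' le(1,2) by (metis le_zero_eq not_gr_zero)+
  have fin: "peval a p * peval a q < \<infinity>"
    using Mult.prems(4) enat_ord_simps(3) unfolding peval.simps by (rule less_le_trans)
  show ?case
  proof (cases "peval b p * peval b q = \<infinity>")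
    case True
    with fin show ?thesis by simp
  next
    case False
    from ex show ?thesis
    proof
      assume "peval a p < peval b' p"
      from enat_mult_less_mono[OF gr(1)[OF this] le(2) pos(2)] False show ?thesis by simp
    next
      assume "peval a q < peval b' q"
      from enat_mult_less_mono[OF gr(2)[OF this] le(1) pos(1)] False show ?thesis
        by (simp add: mult.commute)
    qed
  qed
qed auto

text \<open>Continuity along increasing chains, phrased through finite lower bounds \<open>m\<close>
  so that finite and infinite values at the supremum are treated alike.\<close>

lemma peval_SUP:
  fixes a :: "nat \<Rightarrow> enat list"
  assumes "\<forall>j\<in>vars p. incseq (\<lambda>k. a k ! j)" "\<forall>j\<in>vars p. b ! j = (SUP k. a k ! j)"
    and "enat m \<le> peval b p"
  shows "\<exists>k. enat m \<le> peval (a k) p"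
  using assms
proof (induction p arbitrary: m)
  case (Var i)
  then have i: "b ! i = (SUP k. a k ! i)" by auto
  show ?case
  proof (rule ccontr)
    assume "\<not> ?thesis"
    \<comment> \<open>If every stage is below \<open>m\<close>, then \<open>m\<close> is a successor
      and its predecessor bounds all stages, hence also their supremum.\<close>
    then have *: "a k ! i < enat m" for k by (auto simp: not_le)
    then obtain m' where m: "m = Suc m'" by (cases m) (auto simp: zero_enat_def[symmetric])
    have "a k ! i \<le> enat m'" for k using *[of k] m by (cases "a k ! i") auto
    then have "b ! i \<le> enat m'" unfolding i by (rule SUP_least)
    then show False using Var.prems(3) m by (cases "b ! i") auto
  qed
next
  case (Add p q)
  have "\<exists>m1 m2. m = m1 + m2 \<and> enat m1 \<le> peval b p \<and> enat m2 \<le> peval b q"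
  proof (cases "enat m \<le> peval b p")
    case True
    then show ?thesis by (intro exI[of _ m] exI[of _ 0]) (auto simp: zero_enat_def[symmetric])
  next
    case False
    then obtain k where k: "peval b p = enat k" "k < m" by (cases "peval b p") auto
    with Add.prems(3) have "enat (m - k) \<le> peval b q" by (cases "peval b q") auto
    with k show ?thesis by (intro exI[of _ k] exI[of _ "m-k"]) auto
  qed
  then obtain m1 m2 where m: "m = m1 + m2" "enat m1 \<le> peval b p" "enat m2 \<le> peval b q" by auto
  obtain k1 k2 where k: "enat m1 \<le> peval (a k1) p" "enat m2 \<le> peval (a k2) q"
    using Add.IH(1)[OF _ _ m(2)] Add.IH(2)[OF _ _ m(3)] Add.prems(1,2) by auto
  have "peval (a k1) p \<le> peval (a (max k1 k2)) p" "peval (a k2) q \<le> peval (a (max k1 k2)) q"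
    using Add.prems(1) by (auto intro!: peval_mono simp: incseq_def)
  with k have "enat m1 + enat m2 \<le> peval (a (max k1 k2)) p + peval (a (max k1 k2)) q"
    by (intro add_mono) auto
  then show ?case using m by auto
next
  case (Mult p q)
  show ?case
  proof (cases "m = 0")
    case False
    \<comment> \<open>For an infinite factor the bound \<open>m\<close> itself suffices: the other
      factor is nonzero because \<open>m\<close> is, so it is at least 1.\<close>
    have "\<exists>m1 m2. m \<le> m1 * m2 \<and> enat m1 \<le> peval b p \<and> enat m2 \<le> peval b q"
      using Mult.prems(3) False
    proof (cases "peval b p"; cases "peval b q")
      fix x y assume "peval b p = enat x" "peval b q = enat y"
      then show ?thesis using Mult.prems(3) by (intro exI[of _ x] exI[of _ y]) auto
    next
      fix x assume *: "peval b p = enat x" "peval b q = \<infinity>"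
      then have "x \<noteq> 0" using Mult.prems(3) False by (auto simp: zero_enat_def split: if_splits)
      with * show ?thesis by (intro exI[of _ x] exI[of _ m]) auto
    next
      fix x assume *: "peval b q = enat x" "peval b p = \<infinity>"
      then have "x \<noteq> 0" using Mult.prems(3) False by (auto simp: zero_enat_def split: if_splits)
      with * show ?thesis by (intro exI[of _ m] exI[of _ x]) auto
    next
      assume *: "peval b p = \<infinity>" "peval b q = \<infinity>"
      then show ?thesis by (intro exI[of _ m] exI[of _ m]) auto
    qed
    then obtain m1 m2 where m: "m \<le> m1 * m2" "enat m1 \<le> peval b p" "enat m2 \<le> peval b q" by auto
    obtain k1 k2 where k: "enat m1 \<le> peval (a k1) p" "enat m2 \<le> peval (a k2) q"
      using Mult.IH(1)[OF _ _ m(2)] Mult.IH(2)[OF _ _ m(3)] Mult.prems(1,2) by auto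
    have "peval (a k1) p \<le> peval (a (max k1 k2)) p" "peval (a k2) q \<le> peval (a (max k1 k2)) q"
      using Mult.prems(1) by (auto intro!: peval_mono simp: incseq_def)
    with k have "enat m1 * enat m2 \<le> peval (a (max k1 k2)) p * peval (a (max k1 k2)) q"
      by (intro mult_mono) auto
    moreover have "enat m \<le> enat m1 * enat m2" using m by simp
    ultimately have "enat m \<le> peval (a (max k1 k2)) (Mult p q)" by (simp del: times_enat_simps)
    then show ?thesis ..
  qed (auto simp: zero_enat_def[symmetric])
qed auto

text \<open>The chain grows strictly until its first repetition and is constant from then on; inside
  a set of \<open>n\<close> elements at most \<open>n\<close> strict steps fit. Allowing any
  \<open>N\<close> above \<open>n\<close> permits a cruder bound in the algorithm.\<close>

lemma increasing_subsets_stabilize: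
  fixes S :: "nat \<Rightarrow> nat set"
  assumes "\<And>k. S k \<subseteq> {..<n}" "\<And>k. S k \<subseteq> S (Suc k)"
    and "\<And>k. S k = S (Suc k) \<Longrightarrow> S (Suc (Suc k)) \<subseteq> S (Suc k)"
    and "n \<le> N"
  shows "S m \<subseteq> S N"
proof -
  have mono: "mono S" using assms(2) by (simp add: mono_iff_le_Suc)
  have fin: "finite (range S)"
    by (rule finite_subset[of _ "Pow {..<n}"]) (use assms(1) in auto)
  have "S (card {..<n}) = (\<Union>k. S k)"
  proof (rule finite_mono_strict_prefix_implies_finite_fixpoint)
    have "S (Suc k) = S (Suc (Suc k))" if "S k = S (Suc k)" for k
      using assms(2)[of "Suc k"] assms(3)[OF that] by (rule subset_antisym)
    then show "\<exists>N. (\<forall>n\<le>N. \<forall>m\<le>N. m < n \<longrightarrow> S m \<subset> S n) \<and> (\<forall>n\<ge>N. S N = S n)"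
      using finite_mono_remains_stable_implies_strict_prefix[OF fin mono] by blast
  qed (use assms(1) in auto)
  then have "S m \<subseteq> S n" by auto
  also have "\<dots> \<subseteq> S N" using mono assms(4) by (rule monoD)
  finally show ?thesis .
qed

section \<open>Kleene iterates, their supremum and the least solution\<close>

definition kleene_iter :: "pexp list \<Rightarrow> nat \<Rightarrow> enat list" where
  "kleene_iter F k = ((\<lambda>a. map (peval a) F) ^^ k) (replicate (length F) 0)"

lemma kleene_iter_0: "kleene_iter F 0 = replicate (length F) 0"
  and kleene_iter_Suc: "kleene_iter F (Suc k) = map (peval (kleene_iter F k)) F"
  by (simp_all add: kleene_iter_def)

lemma length_kleene_iter [simp]: "length (kleene_iter F k) = length F"
  by (cases k) (simp_all add: kleene_iter_0 kleene_iter_Suc)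

lemma nth_kleene_iter_Suc:
  "i < length F \<Longrightarrow> kleene_iter F (Suc k) ! i = peval (kleene_iter F k) (F ! i)"
  by (simp add: kleene_iter_Suc)

definition kleene_lfp :: "pexp list \<Rightarrow> enat list" where
  "kleene_lfp F = map (\<lambda>i. SUP k. kleene_iter F k ! i) [0..<length F]"

lemma length_kleene_lfp [simp]: "length (kleene_lfp F) = length F"
  by (simp add: kleene_lfp_def)

lemma nth_kleene_lfp: "i < length F \<Longrightarrow> kleene_lfp F ! i = (SUP k. kleene_iter F k ! i)"
  by (simp add: kleene_lfp_def)

lemma poly_systemD: "poly_system F \<Longrightarrow> i < length F \<Longrightarrow> j \<in> vars (F ! i) \<Longrightarrow> j < length F"
  by (auto simp: poly_system_def dest!: nth_mem)

context
  fixes F :: "pexp list"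
  assumes F: "poly_system F"
begin

lemma incseq_kleene_iter:
  assumes "i < length F"
  shows "incseq (\<lambda>k. kleene_iter F k ! i)"
proof -
  have "\<forall>i<length F. kleene_iter F k ! i \<le> kleene_iter F (Suc k) ! i" for k
  proof (induction k)
    case 0 then show ?case by (simp add: kleene_iter_0)
  next
    case (Suc k)
    then show ?case
      using poly_systemD[OF F] by (auto simp: nth_kleene_iter_Suc intro!: peval_mono)
  qed
  with assms show ?thesis by (intro incseq_SucI) auto
qed

lemma kleene_iter_mono:
  "i < length F \<Longrightarrow> k \<le> l \<Longrightarrow> kleene_iter F k ! i \<le> kleene_iter F l ! i"
  using incseq_kleene_iter by (auto simp: incseq_def)

lemma kleene_iter_le_lfp: "i < length F \<Longrightarrow> kleene_iter F k ! i \<le> kleene_lfp F ! i"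
  by (auto simp: nth_kleene_lfp intro: SUP_upper)

text \<open>One inequality is continuity of the polynomials, the other their monotonicity.\<close>

lemma kleene_lfp_fixpoint:
  assumes i: "i < length F"
  shows "peval (kleene_lfp F) (F ! i) = kleene_lfp F ! i"
proof (rule antisym)
  show "peval (kleene_lfp F) (F ! i) \<le> kleene_lfp F ! i"
  proof (rule ccontr)
    assume "\<not> ?thesis"
    \<comment> \<open>The component is finite here, being strictly below another value;
      \<open>m\<close> is its successor.\<close>
    then obtain m where m: "kleene_lfp F ! i < enat m" "enat m \<le> peval (kleene_lfp F) (F ! i)"
      by (cases "kleene_lfp F ! i"; cases "peval (kleene_lfp F) (F ! i)")
        (auto simp: not_le intro: that[of "Suc _"])
    obtain k where "enat m \<le> peval (kleene_iter F k) (F ! i)"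
      using peval_SUP[of "F ! i" "kleene_iter F" "kleene_lfp F" m] m(2) i
        incseq_kleene_iter nth_kleene_lfp poly_systemD[OF F] by blast
    also have "\<dots> \<le> kleene_lfp F ! i"
      using kleene_iter_le_lfp[OF i, of "Suc k"] i by (simp add: nth_kleene_iter_Suc)
    finally show False using m(1) by simp
  qed
  show "kleene_lfp F ! i \<le> peval (kleene_lfp F) (F ! i)"
    unfolding nth_kleene_lfp[OF i]
  proof (rule SUP_least)
    fix k
    have "kleene_iter F k ! i \<le> kleene_iter F (Suc k) ! i" using i by (simp add: kleene_iter_mono)
    also have "\<dots> \<le> peval (kleene_lfp F) (F ! i)"
      using i kleene_iter_le_lfp poly_systemD[OF F]
      by (auto simp: nth_kleene_iter_Suc intro!: peval_mono)
    finally show "kleene_iter F k ! i \<le> peval (kleene_lfp F) (F ! i)" .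
  qed
qed

lemma minimal_solution_kleene_lfp: "minimal_solution F (kleene_lfp F)"
  unfolding minimal_solution_def
proof (intro conjI allI impI)
  show "solution F (kleene_lfp F)"
    unfolding solution_def by (intro conjI nth_equalityI) (simp_all add: kleene_lfp_fixpoint)
  fix b assume b: "solution F b"
  then have len: "length b = length F" and "b = map (peval b) F"
    by (auto simp only: solution_def)
  then have fp: "peval b (F ! i) = b ! i" if "i < length F" for i
    using that by (metis nth_map)
  have "\<forall>i<length F. kleene_iter F k ! i \<le> b ! i" for k
  proof (induction k)
    case 0 then show ?case by (simp add: kleene_iter_0)
  next
    case (Suc k)
    show ?case
    proof (intro allI impI)
      fix i assume i: "i < length F"
      have "peval (kleene_iter F k) (F ! i) \<le> peval b (F ! i)"
        using Suc i poly_systemD[OF F] by (auto intro!: peval_mono)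
      then show "kleene_iter F (Suc k) ! i \<le> b ! i" using i fp by (simp add: nth_kleene_iter_Suc)
    qed
  qed
  then show "list_all2 (\<le>) (kleene_lfp F) b"
    by (auto simp: list_all2_conv_all_nth len nth_kleene_lfp intro: SUP_least)
qed

lemma finite_kleene_lfp_attained:
  assumes i: "i < length F" and fin: "kleene_lfp F ! i \<noteq> \<infinity>" and "length F \<le> N"
  shows "kleene_iter F N ! i = kleene_lfp F ! i"
proof -
  define \<mu> where "\<mu> = kleene_lfp F"
  define a where "a = kleene_iter F"
  define S where "S k = {i. i < length F \<and> \<mu> ! i \<noteq> \<infinity> \<and> a k ! i = \<mu> ! i}" for k
  have le: "a k ! i \<le> \<mu> ! i" if "i < length F" for k i
    using that kleene_iter_le_lfp by (simp add: a_def \<mu>_def)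
  have step: "S k \<subseteq> S (Suc k)" for k
  proof
    fix i assume "i \<in> S k"
    then have "i < length F" "\<mu> ! i \<noteq> \<infinity>" "a k ! i = \<mu> ! i" by (simp_all add: S_def)
    with kleene_iter_mono[of i k "Suc k"] le[of i "Suc k"] show "i \<in> S (Suc k)"
      by (simp add: S_def a_def)
  qed
  have "S (Suc (Suc k)) \<subseteq> S (Suc k)" if eq: "S k = S (Suc k)" for k
  proof
    fix i assume "i \<in> S (Suc (Suc k))"
    then have i: "i < length F" "\<mu> ! i \<noteq> \<infinity>" "a (Suc (Suc k)) ! i = \<mu> ! i" by (auto simp: S_def)
    have \<mu>i: "peval \<mu> (F ! i) = \<mu> ! i" using i kleene_lfp_fixpoint by (simp add: \<mu>_def)
    have v: "\<forall>j\<in>vars (F ! i). j < length F" using i poly_systemD[OF F] by auto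
    have "a (Suc k) ! i = \<mu> ! i"
    proof (rule ccontr)
      assume "a (Suc k) ! i \<noteq> \<mu> ! i"
      then have lt: "peval (a k) (F ! i) < peval \<mu> (F ! i)"
        using le[OF i(1), of "Suc k"] i(1) \<mu>i by (simp add: a_def nth_kleene_iter_Suc)
      \<comment> \<open>Because \<open>S\<close> repeats, every argument short of a finite limit at
        stage \<open>k\<close> is still short at stage \<open>Suc k\<close>. Hence the value
        computed from stage \<open>Suc k\<close> is short as well, contradicting membership of
        \<open>i\<close> in \<open>S (Suc (Suc k))\<close>.\<close>
      have "peval (a (Suc k)) (F ! i) < peval \<mu> (F ! i)"
      proof (rule peval_less_mono[OF _ _ _ lt])
        show "\<forall>j\<in>vars (F ! i). a k ! j < \<mu> ! j \<longrightarrow> a (Suc k) ! j < \<mu> ! j \<or> \<mu> ! j = \<infinity>"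
        proof (intro ballI impI)
          fix j assume j: "j \<in> vars (F ! i)" "a k ! j < \<mu> ! j"
          then have "j \<notin> S k" by (auto simp: S_def)
          then have "j \<notin> S (Suc k)" using eq by simp
          then show "a (Suc k) ! j < \<mu> ! j \<or> \<mu> ! j = \<infinity>"
            using j v le[of j "Suc k"] by (auto simp: S_def)
        qed
      qed (use v le i(2) \<mu>i in auto)
      with i \<mu>i show False by (simp add: a_def nth_kleene_iter_Suc)
    qed
    then show "i \<in> S (Suc k)" using i by (simp add: S_def)
  qed
  note stationary = this
  have stable: "S k \<subseteq> S N" for k
  proof (rule increasing_subsets_stabilize[of S, OF _ _ _ assms(3)])
    show "S k = S (Suc k) \<Longrightarrow> S (Suc (Suc k)) \<subseteq> S (Suc k)" for k
      by (rule stationary)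
    show "S k \<subseteq> S (Suc k)" for k by (rule step)
    show "S k \<subseteq> {..<length F}" for k by (auto simp: S_def)
  qed
  obtain m where m: "\<mu> ! i = enat m" using fin by (auto simp: \<mu>_def)
  \<comment> \<open>Continuity for the polynomial \<open>Var i\<close> yields a stage at which the
    finite supremum is reached.\<close>
  have "\<forall>j\<in>vars (Var i). incseq (\<lambda>k. kleene_iter F k ! j)"
    "\<forall>j\<in>vars (Var i). \<mu> ! j = (SUP k. kleene_iter F k ! j)"
    using i by (auto simp: incseq_kleene_iter nth_kleene_lfp \<mu>_def)
  from peval_SUP[OF this, of m] obtain k where "\<mu> ! i \<le> a k ! i"
    using m by (auto simp: a_def)
  with le[OF i] have "a k ! i = \<mu> ! i" by (rule antisym)
  with i m have "i \<in> S k" by (simp add: S_def)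
  with stable have "i \<in> S N" by blast
  then show ?thesis by (simp add: S_def a_def \<mu>_def)
qed

text \<open>The sets of components that have grown since stage \<open>c\<close> form a chain to
  which the stabilisation lemma applies. A component outside the set at \<open>N\<close> is
  therefore outside all of them. The value at \<open>c\<close> may itself be \<infinity>.\<close>

lemma kleene_iter_stationary:
  assumes i: "i < length F" and eq: "kleene_iter F (c + N) ! i = kleene_iter F c ! i"
    and "length F \<le> N"
  shows "kleene_lfp F ! i = kleene_iter F c ! i"
proof -
  define a where "a k = kleene_iter F (c + k)" for k
  define S where "S k = {i. i < length F \<and> a 0 ! i < a k ! i}" for k
  have mono: "a k ! i \<le> a l ! i" if "i < length F" "k \<le> l" for k l i
    using that kleene_iter_mono by (simp add: a_def)
  have Suc: "a (Suc k) ! i = peval (a k) (F ! i)" if "i < length F" for k i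
    using that by (simp add: a_def nth_kleene_iter_Suc)
  have step: "S k \<subseteq> S (Suc k)" for k
    using mono[of _ k "Suc k"] by (auto simp: S_def intro: less_le_trans)
  have "S (Suc (Suc k)) \<subseteq> S (Suc k)" if eqS: "S k = S (Suc k)" for k
  proof
    fix i assume "i \<in> S (Suc (Suc k))"
    then have i: "i < length F" "a 0 ! i < a (Suc (Suc k)) ! i" by (auto simp: S_def)
    have v: "\<forall>j\<in>vars (F ! i). j < length F" using i poly_systemD[OF F] by auto
    \<comment> \<open>Growth in the very first step persists by monotonicity. Otherwise
      \<open>a 0 ! i\<close> equals the value of the polynomial at \<open>a 0\<close>, so that
      \<open>peval_grows\<close> can compare the values at \<open>a 0\<close>, \<open>a k\<close>
      and \<open>a (Suc k)\<close>.\<close>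
    have "a 0 ! i < a (Suc k) ! i"
    proof (cases "a 0 ! i < a (Suc 0) ! i")
      case True
      then show ?thesis using mono[OF i(1), of "Suc 0" "Suc k"] by (auto intro: less_le_trans)
    next
      case False
      then have a01: "a 0 ! i = a (Suc 0) ! i" using mono[OF i(1), of 0 "Suc 0"] by auto
      have "peval (a 0) (F ! i) < peval (a k) (F ! i)"
      proof (rule peval_grows)
        show "peval (a 0) (F ! i) < peval (a (Suc k)) (F ! i)"
          using i a01 by (simp add: Suc)
        show "\<forall>j\<in>vars (F ! i). a 0 ! j < a (Suc k) ! j \<longrightarrow> a 0 ! j < a k ! j"
          using eqS v by (auto simp: S_def)
      qed (use v mono in auto)
      then show ?thesis using i a01 by (simp add: Suc)
    qed
    then show "i \<in> S (Suc k)" using i by (simp add: S_def)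
  qed
  note stationary = this
  have stable: "S k \<subseteq> S N" for k
  proof (rule increasing_subsets_stabilize[of S, OF _ _ _ assms(3)])
    show "S k = S (Suc k) \<Longrightarrow> S (Suc (Suc k)) \<subseteq> S (Suc k)" for k
      by (rule stationary)
    show "S k \<subseteq> S (Suc k)" for k by (rule step)
    show "S k \<subseteq> {..<length F}" for k by (auto simp: S_def)
  qed
  have "i \<notin> S N" using eq by (simp add: S_def a_def)
  then have "i \<notin> S k" for k using stable by auto
  then have "a k ! i \<le> a 0 ! i" for k using i by (auto simp: S_def not_less)
  then have "kleene_iter F k ! i \<le> kleene_iter F c ! i" for k
    using order_trans[OF kleene_iter_mono[OF i, of k "c + k"]] by (simp add: a_def)
  then show ?thesis
    by (intro antisym) (auto simp: nth_kleene_lfp i intro: SUP_least SUP_upper)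
qed

text \<open>If the stages differ, the component is not finite, for a finite one is attained at every
  stage from \<open>N\<close> on. The extra successor is there because the algorithm evaluates the
  polynomials once more at stages \<open>N\<close> and \<open>N + N\<close>.\<close>

lemma nth_kleene_lfp_eq:
  assumes "i < length F" "length F \<le> N"
  shows "kleene_lfp F ! i =
    (if kleene_iter F (Suc N) ! i = kleene_iter F (Suc (N + N)) ! i
     then kleene_iter F (Suc N) ! i else \<infinity>)"
proof (cases "kleene_iter F (Suc N) ! i = kleene_iter F (Suc (N + N)) ! i")
  case True
  then show ?thesis using kleene_iter_stationary[of i "Suc N" N] assms by simp
next
  case False
  have "kleene_lfp F ! i = \<infinity>"
  proof (rule ccontr)
    assume "kleene_lfp F ! i \<noteq> \<infinity>"
    from finite_kleene_lfp_attained[OF assms(1) this] False assms(2) show False by simp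
  qed
  with False show ?thesis by simp
qed

end

section \<open>Closure properties of the computable functions\<close>

definition computable :: "nat \<Rightarrow> (nat list \<Rightarrow> nat) \<Rightarrow> bool" where
  "computable k f \<longleftrightarrow> (\<exists>r. \<forall>xs. length xs = k \<longrightarrow> computes r xs (f xs))"

named_theorems comp_intros

text \<open>Discharges the positive arity required by \<open>computable_hd\<close>, so that
  \<open>comp_intros\<close> can follow the syntax of a function body.\<close>

declare zero_less_Suc [comp_intros]

section \<open>Composition, projections and primitive recursion\<close>

lemma computable_cong:
  assumes "computable k f" "\<And>xs. length xs = k \<Longrightarrow> f xs = g xs"
  shows "computable k g"
  using assms by (fastforce simp: computable_def)

lemma computable_nth [comp_intros]: "i < k \<Longrightarrow> computable k (\<lambda>xs. xs ! i)"
  unfolding computable_def by (intro exI[of _ "Proj i"]) (auto intro: computes.Proj)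

lemma computable_comp:
  assumes f: "computable (length gs) f" and gs: "\<forall>g\<in>set gs. computable k g"
  shows "computable k (\<lambda>xs. f (map (\<lambda>g. g xs) gs))"
proof -
  obtain r where r: "\<And>xs. length xs = length gs \<Longrightarrow> computes r xs (f xs)"
    using f by (auto simp: computable_def)
  obtain s where s: "\<And>g xs. g \<in> set gs \<Longrightarrow> length xs = k \<Longrightarrow> computes (s g) xs (g xs)"
    using gs unfolding computable_def by metis
  have "computes (Comp r (map s gs)) xs (f (map (\<lambda>g. g xs) gs))" if "length xs = k" for xs
    by (rule computes.Comp[where ys = "map (\<lambda>g. g xs) gs"])
      (auto simp: list_all2_conv_all_nth s r that)
  then show ?thesis unfolding computable_def by blast
qed

lemma computable_Suc [comp_intros]:
  assumes "computable k f"
  shows "computable k (\<lambda>xs. Suc (f xs))"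
proof -
  have "computable (length [f]) (\<lambda>xs. Suc (xs ! 0))"
    unfolding computable_def
    by (intro exI[of _ Succ]) (auto simp: length_Suc_conv intro: computes.Succ)
  from computable_comp[OF this] assms show ?thesis by simp
qed

lemma computable_const [comp_intros]: "computable k (\<lambda>_. c)"
proof (induction c)
  case 0
  show ?case unfolding computable_def by (intro exI[of _ Zero]) (auto intro: computes.Zero)
qed (rule computable_Suc)

text \<open>Composition with \<open>g\<close> followed by all projections: the value of
  \<open>g\<close> is pushed in front of the arguments, where \<open>hd\<close> reads it, as with de
  Bruijn indices.\<close>

lemma computable_let:
  assumes f: "computable (Suc k) (\<lambda>ys. f (tl ys) (hd ys))" and g: "computable k g"
  shows "computable k (\<lambda>xs. f xs (g xs))"
proof -
  let ?gs = "g # map (\<lambda>i xs. xs ! i) [0..<k]"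
  have "computable k (\<lambda>xs. (\<lambda>ys. f (tl ys) (hd ys)) (map (\<lambda>g. g xs) ?gs))"
    using f g by (intro computable_comp) (auto intro: computable_nth)
  then show ?thesis by (rule computable_cong) (auto simp: comp_def map_nth)
qed

text \<open>Weakening by one bound variable, obtained by composing with the projections shifted by
  one.\<close>

lemma computable_tl [comp_intros]:
  assumes "computable k f"
  shows "computable (Suc k) (\<lambda>ys. f (tl ys))"
proof -
  let ?gs = "map (\<lambda>i ys. ys ! Suc i) [0..<k]"
  have "computable (Suc k) (\<lambda>ys. f (map (\<lambda>g. g ys) ?gs))"
    using assms by (intro computable_comp) (auto intro: computable_nth)
  then show ?thesis
  proof (rule computable_cong)
    fix ys :: "nat list" assume "length ys = Suc k"
    then have "map (\<lambda>g. g ys) ?gs = tl ys"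
      by (intro nth_equalityI) (auto simp: nth_tl)
    then show "f (map (\<lambda>g. g ys) ?gs) = f (tl ys)" by (rule arg_cong)
  qed
qed

lemma computable_hd [comp_intros]: "0 < k \<Longrightarrow> computable k hd"
  by (rule computable_cong[OF computable_nth[of 0]]) (auto simp: hd_conv_nth)

text \<open>
  Bound variables are pushed onto the argument list: in the step function \<open>hd ys\<close> is the counter,
  \<open>hd (tl ys)\<close> the value so far, and \<open>tl (tl ys)\<close> the list of the outer arguments.
\<close>

lemma computable_rec_nat [comp_intros]:
  assumes b: "computable k b" and c: "computable k c"
    and s: "computable (Suc (Suc k)) (\<lambda>ys. s (tl (tl ys)) (hd ys) (hd (tl ys)))"
  shows "computable k (\<lambda>xs. rec_nat (b xs) (s xs) (c xs))"
proof -
  obtain rb rs where rb: "\<And>xs. length xs = k \<Longrightarrow> computes rb xs (b xs)"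
    and rs: "\<And>ys. length ys = Suc (Suc k) \<Longrightarrow> computes rs ys (s (tl (tl ys)) (hd ys) (hd (tl ys)))"
    using b s by (auto simp: computable_def)
  have "computes (PrimRec rb rs) (n # xs) (rec_nat (b xs) (s xs) n)" if "length xs = k" for n xs
  proof (induction n)
    case 0
    show ?case using rb[OF that] by (auto intro: computes.PrimRec_0)
  next
    case (Suc n)
    from computes.PrimRec_Suc[OF Suc] rs[of "n # rec_nat (b xs) (s xs) n # xs"] that
    show ?case by simp
  qed
  then have "computable (Suc k) (\<lambda>ys. rec_nat (b (tl ys)) (s (tl ys)) (hd ys))"
    unfolding computable_def by (intro exI[of _ "PrimRec rb rs"]) (auto simp: length_Suc_conv)
  from computable_let[OF this c] show ?thesis .
qed

section \<open>Arithmetic and case distinctions\<close>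

lemma computable_pred [comp_intros]:
  assumes "computable k a" shows "computable k (\<lambda>xs. a xs - Suc 0)"
proof -
  have "computable k (\<lambda>xs. rec_nat 0 (\<lambda>n _. n) (a xs))"
    by (intro comp_intros assms)
  moreover have "rec_nat 0 (\<lambda>n _. n) m = m - Suc 0" for m by (cases m) auto
  ultimately show ?thesis by simp
qed

lemma computable_add [comp_intros]:
  assumes "computable k a" "computable k b" shows "computable k (\<lambda>xs. a xs + b xs)"
proof -
  have "computable k (\<lambda>xs. rec_nat (b xs) (\<lambda>_ z. Suc z) (a xs))"
    by (intro comp_intros assms)
  moreover have "rec_nat n (\<lambda>_ z. Suc z) m = m + n" for m n by (induction m) auto
  ultimately show ?thesis by simp
qed

lemma computable_mult [comp_intros]:
  assumes "computable k a" "computable k b" shows "computable k (\<lambda>xs. a xs * b xs)"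
proof -
  have "computable k (\<lambda>xs. rec_nat 0 (\<lambda>_ z. b xs + z) (a xs))"
    by (intro comp_intros assms)
  moreover have "rec_nat 0 (\<lambda>_ z. n + z) m = m * n" for m n by (induction m) auto
  ultimately show ?thesis by simp
qed

lemma computable_diff [comp_intros]:
  assumes "computable k a" "computable k b" shows "computable k (\<lambda>xs. a xs - b xs)"
proof -
  have "computable k (\<lambda>xs. rec_nat (a xs) (\<lambda>_ z. z - Suc 0) (b xs))"
    by (intro comp_intros assms)
  moreover have "rec_nat m (\<lambda>_ z. z - Suc 0) n = m - n" for m n by (induction n) auto
  ultimately show ?thesis by simp
qed

lemma computable_if_zero:
  assumes "computable k c" "computable k a" "computable k b"
  shows "computable k (\<lambda>xs. if c xs = 0 then a xs else b xs)"
proof -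
  have "computable k (\<lambda>xs. rec_nat (a xs) (\<lambda>_ _. b xs) (c xs))"
    by (intro comp_intros assms)
  moreover have "rec_nat m (\<lambda>_ _. n) l = (if l = 0 then m else n)" for m n l :: nat by (cases l) auto
  ultimately show ?thesis by simp
qed

text \<open>Truncated subtraction turns the comparison into a test for zero.\<close>

lemma computable_if_le [comp_intros]:
  assumes "computable k c" "computable k d" "computable k a" "computable k b"
  shows "computable k (\<lambda>xs. if c xs \<le> d xs then a xs else b xs)"
  using computable_if_zero[of k "\<lambda>xs. c xs - d xs", OF computable_diff] assms by simp

lemma computable_if_eq [comp_intros]:
  assumes "computable k c" "computable k d" "computable k a" "computable k b"
  shows "computable k (\<lambda>xs. if c xs = d xs then a xs else b xs)"
proof -
  have "computable k (\<lambda>xs. if c xs \<le> d xs then if d xs \<le> c xs then a xs else b xs else b xs)"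
    by (intro comp_intros assms)
  then show ?thesis by (rule computable_cong) auto
qed

section \<open>The Cantor pairing function and its inverse\<close>

lemma triangle_eq_rec_nat: "triangle n = rec_nat 0 (\<lambda>m z. z + Suc m) n"
  by (induction n) auto

lemma computable_triangle [comp_intros]:
  "computable k a \<Longrightarrow> computable k (\<lambda>xs. triangle (a xs))"
  unfolding triangle_eq_rec_nat by (intro comp_intros)

lemma computable_prod_encode [comp_intros]:
  "computable k a \<Longrightarrow> computable k b \<Longrightarrow> computable k (\<lambda>xs. prod_encode (a xs, b xs))"
  unfolding prod_encode_def by (simp, intro comp_intros)

text \<open>The index of the last triangular number not exceeding \<open>n\<close>, which is the sum
  of the two components of the pair coded by \<open>n\<close>. When \<open>n\<close> grows by one,
  the index grows by at most one, hence the recursion.\<close>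

definition triangle_root :: "nat \<Rightarrow> nat" where
  "triangle_root n = rec_nat 0 (\<lambda>m z. if triangle (Suc z) \<le> Suc m then Suc z else z) n"

lemma computable_triangle_root [comp_intros]:
  "computable k a \<Longrightarrow> computable k (\<lambda>xs. triangle_root (a xs))"
  unfolding triangle_root_def by (intro comp_intros)

lemma triangle_mono: "m \<le> n \<Longrightarrow> triangle m \<le> triangle n"
  by (induction n rule: dec_induct) auto

lemma triangle_root_bounds:
  "triangle (triangle_root n) \<le> n \<and> n < triangle (Suc (triangle_root n))"
  by (induction n) (auto simp: triangle_root_def simp del: triangle_Suc, auto)

lemma triangle_root_eqI:
  assumes "triangle r \<le> n" "n < triangle (Suc r)"
  shows "triangle_root n = r"
proof (rule linorder_cases[of "triangle_root n" r])
  assume "triangle_root n < r"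
  with triangle_mono[of "Suc (triangle_root n)" r] triangle_root_bounds[of n] assms
  show ?thesis by linarith
next
  assume "r < triangle_root n"
  with triangle_mono[of "Suc r" "triangle_root n"] triangle_root_bounds[of n] assms
  show ?thesis by linarith
qed

text \<open>The code of \<open>(a, b)\<close> is \<open>triangle (a + b) + a\<close>, so the root
  recovers \<open>a + b\<close> and the remainder is \<open>a\<close>.\<close>

lemma fst_prod_decode: "fst (prod_decode n) = n - triangle (triangle_root n)"
  and snd_prod_decode: "snd (prod_decode n) = triangle_root n - (n - triangle (triangle_root n))"
proof -
  obtain a b where ab: "prod_decode n = (a, b)" by fastforce
  then have "n = prod_encode (a, b)" by (metis prod_decode_inverse)
  then have n: "n = triangle (a + b) + a" by (simp add: prod_encode_def)
  then have "triangle_root n = a + b" by (intro triangle_root_eqI) simp_all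
  with ab n show "fst (prod_decode n) = n - triangle (triangle_root n)"
    "snd (prod_decode n) = triangle_root n - (n - triangle (triangle_root n))" by simp_all
qed

lemma computable_fst_prod_decode [comp_intros]:
  "computable k a \<Longrightarrow> computable k (\<lambda>xs. fst (prod_decode (a xs)))"
  unfolding fst_prod_decode by (intro comp_intros)

lemma computable_snd_prod_decode [comp_intros]:
  "computable k a \<Longrightarrow> computable k (\<lambda>xs. snd (prod_decode (a xs)))"
  unfolding snd_prod_decode by (intro comp_intros)

section \<open>Lists coded as numbers\<close>

definition cons_code :: "nat \<Rightarrow> nat \<Rightarrow> nat" where
  "cons_code x l = Suc (prod_encode (x, l))"

definition hd_code :: "nat \<Rightarrow> nat" where
  "hd_code l = fst (prod_decode (l - Suc 0))"

definition drop_code :: "nat \<Rightarrow> nat \<Rightarrow> nat" where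
  "drop_code i l = rec_nat l (\<lambda>_ z. snd (prod_decode (z - Suc 0))) i"

definition nth_code :: "nat \<Rightarrow> nat \<Rightarrow> nat" where
  "nth_code l i = hd_code (drop_code i l)"

text \<open>
  The list is processed from its end. Its code is used as a bound on its length, so that the first
  stages see an empty remainder.
\<close>

definition map_code :: "(nat \<Rightarrow> nat) \<Rightarrow> nat \<Rightarrow> nat" where
  "map_code g l = rec_nat 0 (\<lambda>j z. if drop_code (l - Suc j) l = 0 then 0
     else cons_code (g (hd_code (drop_code (l - Suc j) l))) z) l"

lemma computable_cons_code [comp_intros]:
  "computable k a \<Longrightarrow> computable k b \<Longrightarrow> computable k (\<lambda>xs. cons_code (a xs) (b xs))"
  unfolding cons_code_def by (intro comp_intros)

lemma computable_hd_code [comp_intros]: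
  "computable k a \<Longrightarrow> computable k (\<lambda>xs. hd_code (a xs))"
  unfolding hd_code_def by (intro comp_intros)

lemma computable_drop_code [comp_intros]:
  "computable k a \<Longrightarrow> computable k b \<Longrightarrow> computable k (\<lambda>xs. drop_code (a xs) (b xs))"
  unfolding drop_code_def by (intro comp_intros)

lemma computable_nth_code [comp_intros]:
  "computable k a \<Longrightarrow> computable k b \<Longrightarrow> computable k (\<lambda>xs. nth_code (a xs) (b xs))"
  unfolding nth_code_def by (intro comp_intros)

lemma computable_map_code [comp_intros]:
  assumes l: "computable k l" and g: "computable (Suc k) (\<lambda>ys. g (tl ys) (hd ys))"
  shows "computable k (\<lambda>xs. map_code (g xs) (l xs))"
proof -
  \<comment> \<open>Within the recursion step the counter and the list built so far precede the
    outer arguments, so \<open>g\<close> must be moved past these two positions.\<close>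
  have g': "computable (Suc (Suc k)) (\<lambda>ys. g (tl (tl ys)) (h ys))" if "computable (Suc (Suc k)) h" for h
  proof (rule computable_let[OF _ that])
    \<comment> \<open>The list \<open>zs\<close> holds the value of \<open>h\<close>, the counter,
      the list built so far and then the outer arguments; only the first entry and those from
      position 3 on are kept.\<close>
    let ?gs = "hd # map (\<lambda>i zs. zs ! (i + 3)) [0..<k]"
    have c: "computable (Suc (Suc (Suc k)))
        (\<lambda>zs. (\<lambda>xs. g (tl xs) (hd xs)) (map (\<lambda>g. g zs) ?gs))"
      using g by (intro computable_comp) (auto intro: computable_nth computable_hd)
    show "computable (Suc (Suc (Suc k))) (\<lambda>ys. g (tl (tl (tl ys))) (hd ys))"
    proof (rule computable_cong[OF c])
      fix zs :: "nat list" assume "length zs = Suc (Suc (Suc k))"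
      then have "map (\<lambda>g. g zs) (map (\<lambda>i zs. zs ! (i + 3)) [0..<k]) = tl (tl (tl zs))"
        by (intro nth_equalityI) (auto simp: nth_tl numeral_3_eq_3)
      then show "g (tl (map (\<lambda>g. g zs) ?gs)) (hd (map (\<lambda>g. g zs) ?gs)) =
          g (tl (tl (tl zs))) (hd zs)" by (simp only: list.map list.sel)
    qed
  qed
  show ?thesis
    unfolding map_code_def by (intro comp_intros g' l)
qed

lemma hd_code_Cons [simp]: "hd_code (list_encode (x # xs)) = x"
  by (simp add: hd_code_def)

lemma drop_code_list_encode [simp]: "drop_code i (list_encode xs) = list_encode (drop i xs)"
proof -
  have snd_decode: "snd (prod_decode (list_encode ys - Suc 0)) = list_encode (tl ys)" for ys
  proof (cases ys)
    case Nil
    \<comment> \<open>The empty list has code 0, whose truncated predecessor 0 decodes to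
      \<open>(0, 0)\<close>; so dropping beyond the end yields the empty list again.\<close>
    have "prod_encode (0, 0) = 0" by (simp add: prod_encode_def)
    then have "prod_decode 0 = (0, 0)" by (metis prod_encode_inverse)
    with Nil show ?thesis by simp
  qed simp
  show ?thesis by (induction i) (simp_all add: drop_code_def snd_decode drop_Suc tl_drop)
qed

lemma nth_code_list_encode [simp]:
  "i < length xs \<Longrightarrow> nth_code (list_encode xs) i = xs ! i"
  by (simp add: nth_code_def Cons_nth_drop_Suc[symmetric] del: list_encode.simps)

text \<open>Each constructor adds at least one to the code of the tail. This makes a code usable as
  an iteration bound.\<close>

lemma length_le_list_encode: "length xs \<le> list_encode xs"
  by (induction xs) (auto intro: order_trans[OF _ le_prod_encode_2])

lemma map_code_list_encode: "map_code g (list_encode xs) = list_encode (map g xs)"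
proof -
  define l where "l = list_encode xs"
  define M where "M = rec_nat 0 (\<lambda>j z. if drop_code (l - Suc j) l = 0 then 0
     else cons_code (g (hd_code (drop_code (l - Suc j) l))) z)"
  \<comment> \<open>Invariant: after \<open>j\<close> stages the part of the list from position
    \<open>l - j\<close> on is done. Initially this part is empty since \<open>l\<close> bounds the
    length; at \<open>j = l\<close> it is the whole list.\<close>
  have "j \<le> l \<Longrightarrow> M j = list_encode (map g (drop (l - j) xs))" for j
  proof (induction j)
    case 0
    then show ?case using length_le_list_encode[of xs] by (simp add: M_def l_def)
  next
    case (Suc j)
    have "l - j = Suc (l - Suc j)" using Suc.prems by simp
    then have "M j = list_encode (map g (drop (Suc (l - Suc j)) xs))" using Suc by simp
    moreover have "M (Suc j) = (if drop_code (l - Suc j) l = 0 then 0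
        else cons_code (g (hd_code (drop_code (l - Suc j) l))) (M j))"
      by (simp add: M_def)
    moreover have "drop_code (l - Suc j) l = list_encode (drop (l - Suc j) xs)"
      by (simp add: l_def)
    ultimately show ?case
      by (cases "drop (l - Suc j) xs")
        (auto simp: cons_code_def drop_Suc tl_drop[symmetric] hd_code_def)
  qed
  moreover have "map_code g l = M l" by (simp only: map_code_def M_def)
  ultimately show ?thesis by (simp add: l_def)
qed

section \<open>Arithmetic of the extended naturals on codes\<close>

definition add_code :: "nat \<Rightarrow> nat \<Rightarrow> nat" where
  "add_code x y = (if x = 0 then 0 else if y = 0 then 0 else x + y - Suc 0)"

text \<open>The code \<open>Suc 0\<close> stands for the number 0 and the code 0 for \<infinity>.
  The number 0 is tested first because it annihilates \<infinity>.\<close>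

definition mult_code :: "nat \<Rightarrow> nat \<Rightarrow> nat" where
  "mult_code x y = (if x = Suc 0 then Suc 0 else if y = Suc 0 then Suc 0
     else if x = 0 then 0 else if y = 0 then 0 else Suc ((x - Suc 0) * (y - Suc 0)))"

lemma add_code_enat_code: "add_code (enat_code x) (enat_code y) = enat_code (x + y)"
  by (auto simp: add_code_def enat_code_def split: enat.splits)

lemma mult_code_enat_code: "mult_code (enat_code x) (enat_code y) = enat_code (x * y)"
  by (cases x; cases y) (auto simp: mult_code_def enat_code_def zero_enat_def split: if_splits)

lemma computable_add_code [comp_intros]:
  "computable k a \<Longrightarrow> computable k b \<Longrightarrow> computable k (\<lambda>xs. add_code (a xs) (b xs))"
  unfolding add_code_def by (intro comp_intros)

lemma computable_mult_code [comp_intros]: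
  "computable k a \<Longrightarrow> computable k b \<Longrightarrow> computable k (\<lambda>xs. mult_code (a xs) (b xs))"
  unfolding mult_code_def by (intro comp_intros)

section \<open>Evaluation of coded polynomials\<close>

definition peval_step :: "nat \<Rightarrow> nat \<Rightarrow> nat \<Rightarrow> nat" where
  "peval_step v m h = (let t = fst (prod_decode m); r = snd (prod_decode m);
     x = nth_code h (m - Suc (fst (prod_decode r)));
     y = nth_code h (m - Suc (snd (prod_decode r)))
   in if t = 0 then r else if t = 1 then nth_code v r
      else if t = 2 then add_code x y else mult_code x y)"

text \<open>
  Course-of-values recursion: the history at \<open>m\<close> lists the values for the codes \<open>m - 1, \<dots>, 0\<close>, so
  that of \<open>x < m\<close> stands at position \<open>m - Suc x\<close>.
\<close>

definition peval_history :: "nat \<Rightarrow> nat \<Rightarrow> nat" where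
  "peval_history v m = rec_nat 0 (\<lambda>m h. cons_code (peval_step v m h) h) m"

definition peval_code :: "nat \<Rightarrow> nat \<Rightarrow> nat" where
  "peval_code v m = peval_step v m (peval_history v m)"

lemma computable_peval_step [comp_intros]:
  "computable k a \<Longrightarrow> computable k b \<Longrightarrow> computable k c \<Longrightarrow>
    computable k (\<lambda>xs. peval_step (a xs) (b xs) (c xs))"
  unfolding peval_step_def Let_def by (intro comp_intros)

lemma computable_peval_code [comp_intros]:
  "computable k a \<Longrightarrow> computable k b \<Longrightarrow> computable k (\<lambda>xs. peval_code (a xs) (b xs))"
  unfolding peval_code_def peval_history_def by (intro comp_intros)

lemma peval_history_eq:
  "peval_history v m = list_encode (map (\<lambda>i. peval_code v (m - Suc i)) [0..<m])"
proof (induction m)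
  case (Suc m)
  have "peval_history v (Suc m) = cons_code (peval_code v m) (peval_history v m)"
    by (simp add: peval_history_def peval_code_def)
  also have "\<dots> = list_encode (map (\<lambda>i. peval_code v (Suc m - Suc i)) [0..<Suc m])"
    unfolding Suc.IH by (simp add: cons_code_def upt_conv_Cons map_Suc_upt[symmetric] comp_def del: upt_Suc)
  finally show ?case .
qed (simp add: peval_history_def)

lemma nth_code_peval_history:
  "x < m \<Longrightarrow> nth_code (peval_history v m) (m - Suc x) = peval_code v x"
  by (simp add: peval_history_eq)

text \<open>A positive tag puts the code beyond the next triangular number, hence above its second
  component. With the tags 2 and 3 the subexpressions thus have smaller codes, and their values are
  found in the history.\<close>

lemma args_less_prod_encode:
  assumes "0 < t" shows "x < prod_encode (t, prod_encode (x, y))" "y < prod_encode (t, prod_encode (x, y))"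
proof -
  have "z < prod_encode (t, z)" for z
    using assms triangle_mono[of "Suc z" "t + z"] by (auto simp: prod_encode_def)
  then show "x < prod_encode (t, prod_encode (x, y))" "y < prod_encode (t, prod_encode (x, y))"
    using le_prod_encode_1 le_prod_encode_2 by (metis le_less_trans)+
qed

lemma peval_code_pexp_code:
  "vars p \<subseteq> {..<length a} \<Longrightarrow> peval_code (vector_code a) (pexp_code p) = enat_code (peval a p)"
proof (induction p)
  case (Const c)
  then show ?case by (simp add: peval_code_def peval_step_def)
next
  case (Var i)
  then show ?case by (simp add: peval_code_def peval_step_def vector_code_def)
next
  case (Add p q)
  then show ?case
    \<comment> \<open>The definition is unfolded only at the compound code, so that the induction
      hypotheses still match the values of the subexpressions.\<close>
    by (simp add: peval_code_def[of _ "prod_encode _"] peval_step_def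
      nth_code_peval_history args_less_prod_encode add_code_enat_code)
next
  case (Mult p q)
  then show ?case
    by (simp add: peval_code_def[of _ "prod_encode _"] peval_step_def
      nth_code_peval_history args_less_prod_encode mult_code_enat_code)
qed

section \<open>The algorithm\<close>

text \<open>Since 1 is the code of the number 0, the recursion starts from the zero vector, with one
  entry for each equation coded in \<open>L\<close>.\<close>

definition kleene_iter_code :: "nat \<Rightarrow> nat \<Rightarrow> nat" where
  "kleene_iter_code L t = rec_nat (map_code (\<lambda>_. 1) L) (\<lambda>_ v. map_code (peval_code v) L) t"

text \<open>
  The code \<open>L\<close> of the system itself serves as the number of iterations, being at least the number
  of equations; \<open>0\<close> is the code of \<open>\<infinity>\<close>.
\<close>

definition kleene_lfp_code :: "nat \<Rightarrow> nat" where
  "kleene_lfp_code L = map_code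
     (\<lambda>f. if peval_code (kleene_iter_code L L) f = peval_code (kleene_iter_code L (L + L)) f
          then peval_code (kleene_iter_code L L) f else 0) L"

lemma computable_kleene_iter_code [comp_intros]:
  "computable k a \<Longrightarrow> computable k b \<Longrightarrow> computable k (\<lambda>xs. kleene_iter_code (a xs) (b xs))"
  unfolding kleene_iter_code_def by (intro comp_intros)

lemma computable_kleene_lfp_code [comp_intros]:
  "computable k a \<Longrightarrow> computable k (\<lambda>xs. kleene_lfp_code (a xs))"
  unfolding kleene_lfp_code_def by (intro comp_intros)

lemma peval_code_system:
  assumes "poly_system F" "f \<in> set F"
  shows "peval_code (vector_code (kleene_iter F t)) (pexp_code f) =
    enat_code (peval (kleene_iter F t) f)"
  using assms by (intro peval_code_pexp_code) (auto simp: poly_system_def)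

lemma kleene_iter_code_system_code:
  assumes F: "poly_system F"
  shows "kleene_iter_code (system_code F) t = vector_code (kleene_iter F t)"
proof (induction t)
  case 0
  show ?case
    by (simp add: kleene_iter_code_def system_code_def map_code_list_encode kleene_iter_0
      vector_code_def enat_code_def zero_enat_def comp_def map_replicate_const)
next
  case (Suc t)
  have "kleene_iter_code (system_code F) (Suc t) =
      map_code (peval_code (vector_code (kleene_iter F t))) (system_code F)"
    using Suc by (simp add: kleene_iter_code_def)
  also have "\<dots> = list_encode (map (\<lambda>f. peval_code (vector_code (kleene_iter F t)) (pexp_code f)) F)"
    by (simp add: system_code_def map_code_list_encode comp_def)
  also have "\<dots> = list_encode (map (\<lambda>f. enat_code (peval (kleene_iter F t) f)) F)"
    by (intro arg_cong[where f = list_encode] map_cong refl peval_code_system[OF F])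
  also have "\<dots> = vector_code (kleene_iter F (Suc t))"
    by (simp add: kleene_iter_Suc vector_code_def comp_def)
  finally show ?case .
qed

lemma kleene_lfp_code_system_code:
  assumes F: "poly_system F"
  shows "kleene_lfp_code (system_code F) = vector_code (kleene_lfp F)"
proof -
  define N where "N = system_code F"
  define u where "u = kleene_iter F N"
  define w where "w = kleene_iter F (N + N)"
  have len: "length F \<le> N"
    using length_le_list_encode[of "map pexp_code F"] by (simp add: N_def system_code_def)
  have "kleene_iter_code N N = vector_code u" "kleene_iter_code N (N + N) = vector_code w"
    by (simp_all only: N_def u_def w_def kleene_iter_code_system_code[OF F])
  then have "kleene_lfp_code N =
      map_code (\<lambda>f. if peval_code (vector_code u) f = peval_code (vector_code w) f
        then peval_code (vector_code u) f else 0) N"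
    by (simp only: kleene_lfp_code_def)
  also have "\<dots> = list_encode (map (\<lambda>f. if peval_code (vector_code u) (pexp_code f) =
      peval_code (vector_code w) (pexp_code f)
      then peval_code (vector_code u) (pexp_code f) else 0) F)"
    by (simp add: N_def system_code_def map_code_list_encode comp_def)
  \<comment> \<open>Comparing codes amounts to comparing values because \<open>enat_code\<close> is
    injective.\<close>
  also have "\<dots> = list_encode (map (\<lambda>f. enat_code (if peval u f = peval w f then peval u f else \<infinity>)) F)"
    using peval_code_system[OF F]
    by (intro arg_cong[where f = list_encode] map_cong refl)
      (simp add: u_def w_def inj_eq[OF inj_enat_code], simp add: enat_code_def)
  also have "\<dots> = vector_code (map (\<lambda>f. if peval u f = peval w f then peval u f else \<infinity>) F)"
    by (simp add: vector_code_def comp_def)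
  \<comment> \<open>Evaluating the polynomials at \<open>u\<close> and \<open>w\<close> gives the
    stages \<open>Suc N\<close> and \<open>Suc (N + N)\<close>.\<close>
  also have "map (\<lambda>f. if peval u f = peval w f then peval u f else \<infinity>) F = kleene_lfp F"
    using nth_kleene_lfp_eq[OF F _ len]
    by (intro nth_equalityI) (simp_all add: u_def w_def nth_kleene_iter_Suc)
  finally show ?thesis by (simp only: N_def)
qed

theorem lemma16:
  shows "\<exists>r :: recf. \<forall>F :: pexp list. poly_system F \<longrightarrow>
           (\<exists>a. minimal_solution F a \<and> computes r [system_code F] (vector_code a))"
proof -
  have "computable 1 (\<lambda>xs. kleene_lfp_code (xs ! 0))"
    by (intro comp_intros) simp
  then obtain r where "\<And>xs. length xs = 1 \<Longrightarrow> computes r xs (kleene_lfp_code (xs ! 0))"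
    by (auto simp: computable_def)
  from this[of "[_]"] have "computes r [n] (kleene_lfp_code n)" for n by simp
  then have "computes r [system_code F] (vector_code (kleene_lfp F))" if "poly_system F" for F
    using kleene_lfp_code_system_code[OF that] by metis
  then show ?thesis using minimal_solution_kleene_lfp by blast
qed

end
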